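(* Let $X=(\boldsymbol X_1,\dots,\boldsymbol X_n)$ be a $p\times n$ random matrix from the multivariate location--scale family with unknown $\boldsymbol\alpha\in\mathbb{R}^p$ and $\boldsymbol\beta=(\beta_1,\dots,\beta_p)$, $\beta_i>0$, and let $U=(\boldsymbol U_1,\dots,\boldsymbol U_{n-1})$ with $\boldsymbol U_j=\boldsymbol X_j-\boldsymbol X_n$. Let $\boldsymbol T(X)$ be an equivariant estimator of $\boldsymbol\alpha$ and $\boldsymbol T_e(U)$ a location invariant, scale equivariant statistic with positive components almost everywhere. Under the strictly convex loss $L(\boldsymbol d,\boldsymbol\alpha,\boldsymbol\beta)=\sum_{i=1}^p h\big((d_i-\alpha_i)/\beta_i\big)$, with $h$ strictly convex, a Pitman closest equivariant estimator of $\boldsymbol\alpha$ within the class of estimators of the form $\boldsymbol\delta(X)=\boldsymbol T(X)-w(Z)\,\boldsymbol T_e(U)$, with $w$ a scalar-valued function of $Z$, is $$\boldsymbol\delta_\pi(X)=\boldsymbol T(X)-m(Z)\,\boldsymbol T_e(U),$$ where $m(Z)$ is a median of the conditional distribution, given $Z$ and under $(\boldsymbol\alpha,\boldsymbol\beta)=(\mathbf 0,\mathbf 1)$, of the univariate random variable $c^*$ defined by $$\boldsymbol T_e(U)^{\top}\,\nabla L_0\big(\boldsymbol T(X)-c^*\boldsymbol T_e(U)\big)=0,\qquad L_0(\boldsymbol e)=L(\boldsymbol e,\mathbf 0,\mathbf 1)=\sum_{i=1}^p h(e_i)\quad(\boldsymbol e\in\mathbb{R}^p).$$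
   Context: Multivariate location--scale family: $X=(\boldsymbol X_1,\dots,\boldsymbol X_n)$ is a $p\times n$ random matrix with joint density $f_{P,\boldsymbol\alpha}(\boldsymbol x_1,\dots,\boldsymbol x_n)=|P|^{-n}f(P^{-1}(\boldsymbol x_1-\boldsymbol\alpha),\dots,P^{-1}(\boldsymbol x_n-\boldsymbol\alpha))$, where $f$ is a given density, $\boldsymbol\alpha\in\mathbb{R}^p$ is an unknown location vector, $P=\mathrm{diag}(\beta_1,\dots,\beta_p)$ with $\beta_i>0$ is an unknown diagonal scale matrix, and $|P|$ is its determinant. Equivariance: an estimator $\boldsymbol\delta(X)$ of $\boldsymbol\alpha$ is equivariant if $\boldsymbol\delta(CX+\boldsymbol a\mathbf 1^{\top})=C\boldsymbol\delta(X)+\boldsymbol a$ for all $\boldsymbol a\in\mathbb{R}^p$ and all $C=\mathrm{diag}(c_1,\dots,c_p)$ with $c_i>0$, where $\boldsymbol a\mathbf 1^{\top}$ is the $p\times n$ matrix all of whose columns equal $\boldsymbol a$. A statistic $\boldsymbol T_e$ with values in $\mathbb{R}^p$ is location invariant and scale equivariant if replacing $X$ by $CX+\boldsymbol a\mathbf 1^{\top}$ replaces $\boldsymbol T_e$ by $C\boldsymbol T_e$; for a function $\boldsymbol T_e(U)$ of $U$ this means $\boldsymbol T_e(CU)=C\boldsymbol T_e(U)$. The statistic $Z$: writing $U=(u_{i,j})$ ($p\times(n-1)$), $Z=(z_{i,j})$ is the $p\times(n-1)$ matrix with $z_{i,j}=u_{i,j}/u_{i,1}$ for $j\ne1$ and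 $z_{i,1}=u_{i,1}/|u_{i,1}|$. Pitman closeness: for estimators $T_1,T_2$, $\mathrm{PC}(T_1,T_2;\boldsymbol\alpha,\boldsymbol\beta)=P_{\boldsymbol\alpha,\boldsymbol\beta}[L(T_1(X),\boldsymbol\alpha,\boldsymbol\beta)<L(T_2(X),\boldsymbol\alpha,\boldsymbol\beta)]$. An estimator $T_1$ in a class is a Pitman closest estimator in the class if $\mathrm{PC}(T_1,T_2;\boldsymbol\alpha,\boldsymbol\beta)\ge\mathrm{PC}(T_2,T_1;\boldsymbol\alpha,\boldsymbol\beta)$ for all $(\boldsymbol\alpha,\boldsymbol\beta)$ and every $T_2$ in the class. Here $h$ is a real-valued function on $\mathbb{R}$, and $\mathbf 1=(1,\dots,1)$. Median: a number $m$ is a median of a univariate random variable $W$ if $P(W<m)\le 1/2$ and $P(W\le m)\ge 1/2$ (similarly for conditional distributions). *)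

theory Defs
  imports "HOL-Probability.Probability"
begin

(* A p x n data matrix, n >= 2, is an element of real^('k option)^'p: row i is the i-th coordinate,
   column None is the observation X_n and the columns Some j are X_1, ..., X_(n-1), so that
   n = CARD('k) + 1. A p x (n-1) matrix such as U or Z is an element of real^'k^'p. *)

definition diag :: "real^'p \<Rightarrow> real^'p^'p" where
  "diag c = (\<chi> i j. if i = j then c $ i else 0)"

(* a 1^T: every column equals a *)
definition rep_cols :: "real^'p \<Rightarrow> real^'n^'p" where
  "rep_cols a = (\<chi> i j. a $ i)"

definition positive_vec :: "real^'p \<Rightarrow> bool" where
  "positive_vec c \<longleftrightarrow> (\<forall>i. 0 < c $ i)"

definition is_density :: "('a::euclidean_space \<Rightarrow> real) \<Rightarrow> bool" where
  "is_density f \<longleftrightarrow> f \<in> borel_measurable borel \<and> (\<forall>x. 0 \<le> f x) \<and>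
     prob_space (density lborel (\<lambda>x. ennreal (f x)))"

definition ls_density :: "(real^'n^'p \<Rightarrow> real) \<Rightarrow> real^'p \<Rightarrow> real^'p \<Rightarrow> real^'n^'p \<Rightarrow> real" where
  "ls_density f \<alpha> \<beta> X =
     f (matrix_inv (diag \<beta>) ** (X - rep_cols \<alpha>)) / det (diag \<beta>) ^ CARD('n)"

(* The distribution of X under (alpha, beta). Estimators and statistics are functions of X,
   and probabilities of events about X are taken in this measure. *)
definition ls_law :: "(real^'n^'p \<Rightarrow> real) \<Rightarrow> real^'p \<Rightarrow> real^'p \<Rightarrow> (real^'n^'p) measure" where
  "ls_law f \<alpha> \<beta> = density lborel (\<lambda>X. ennreal (ls_density f \<alpha> \<beta> X))"

definition equivariant_estimator :: "(real^'n^'p \<Rightarrow> real^'p) \<Rightarrow> bool" where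
  "equivariant_estimator \<delta> \<longleftrightarrow> \<delta> \<in> borel_measurable borel \<and>
     (\<forall>X a c. positive_vec c \<longrightarrow> \<delta> (diag c ** X + rep_cols a) = diag c *v \<delta> X + a)"

(* Location invariance is built in, since S is applied to the differences U. *)
definition scale_equivariant_statistic :: "(real^'k^'p \<Rightarrow> real^'p) \<Rightarrow> bool" where
  "scale_equivariant_statistic S \<longleftrightarrow> S \<in> borel_measurable borel \<and>
     (\<forall>U c. positive_vec c \<longrightarrow> S (diag c ** U) = diag c *v S U)"

definition U_of :: "real^('k option)^'p \<Rightarrow> real^'k^'p" where
  "U_of X = (\<chi> i j. X $ i $ Some j - X $ i $ None)"

(* j1 is the index of the first column. Where u_(i,j1) = 0, a null event under every law of the
   family, the quotients are 0 by the convention x / 0 = 0. *)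
definition Z_of :: "'k \<Rightarrow> real^'k^'p \<Rightarrow> real^'k^'p" where
  "Z_of j1 U = (\<chi> i j. if j = j1 then U $ i $ j1 / \<bar>U $ i $ j1\<bar> else U $ i $ j / U $ i $ j1)"

definition strictly_convex :: "(real \<Rightarrow> real) \<Rightarrow> bool" where
  "strictly_convex h \<longleftrightarrow> (\<forall>x y t. x \<noteq> y \<longrightarrow> 0 < t \<longrightarrow> t < 1 \<longrightarrow>
     h (t * x + (1 - t) * y) < t * h x + (1 - t) * h y)"

definition sum_loss :: "(real \<Rightarrow> real) \<Rightarrow> real^'p \<Rightarrow> real^'p \<Rightarrow> real^'p \<Rightarrow> real" where
  "sum_loss h d \<alpha> \<beta> = (\<Sum>i\<in>UNIV. h ((d $ i - \<alpha> $ i) / \<beta> $ i))"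

definition pitman_closeness ::
  "(real^'n^'p \<Rightarrow> real) \<Rightarrow> (real^'p \<Rightarrow> real^'p \<Rightarrow> real^'p \<Rightarrow> real) \<Rightarrow>
   (real^'n^'p \<Rightarrow> real^'p) \<Rightarrow> (real^'n^'p \<Rightarrow> real^'p) \<Rightarrow> real^'p \<Rightarrow> real^'p \<Rightarrow> real" where
  "pitman_closeness f L T1 T2 \<alpha> \<beta> = measure (ls_law f \<alpha> \<beta>) {X. L (T1 X) \<alpha> \<beta> < L (T2 X) \<alpha> \<beta>}"

definition pitman_closest ::
  "(real^'n^'p \<Rightarrow> real) \<Rightarrow> (real^'p \<Rightarrow> real^'p \<Rightarrow> real^'p \<Rightarrow> real) \<Rightarrow>
   (real^'n^'p \<Rightarrow> real^'p) set \<Rightarrow> (real^'n^'p \<Rightarrow> real^'p) \<Rightarrow> bool" where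
  "pitman_closest f L \<D> T1 \<longleftrightarrow> T1 \<in> \<D> \<and>
     (\<forall>T2\<in>\<D>. \<forall>\<alpha> \<beta>. positive_vec \<beta> \<longrightarrow>
        pitman_closeness f L T1 T2 \<alpha> \<beta> \<ge> pitman_closeness f L T2 T1 \<alpha> \<beta>)"

definition estimator_class ::
  "'k \<Rightarrow> (real^('k option)^'p \<Rightarrow> real^'p) \<Rightarrow> (real^'k^'p \<Rightarrow> real^'p) \<Rightarrow>
   (real^('k option)^'p \<Rightarrow> real^'p) set" where
  "estimator_class j1 T Te = {\<delta>. equivariant_estimator \<delta> \<and>
     (\<exists>w \<in> borel_measurable borel. \<delta> = (\<lambda>X. T X - w (Z_of j1 (U_of X)) *\<^sub>R Te (U_of X)))}"

definition is_median :: "real measure \<Rightarrow> real \<Rightarrow> bool" where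
  "is_median W m \<longleftrightarrow> measure W {..<m} \<le> 1/2 \<and> measure W {..m} \<ge> 1/2"

(* K is a regular conditional distribution of Y given the random element V (with values in N). *)
definition is_cond_distr ::
  "'a measure \<Rightarrow> 'b measure \<Rightarrow> ('a \<Rightarrow> 'b) \<Rightarrow> ('a \<Rightarrow> real) \<Rightarrow> ('b \<Rightarrow> real measure) \<Rightarrow> bool" where
  "is_cond_distr M N V Y K \<longleftrightarrow> K \<in> N \<rightarrow>\<^sub>M prob_algebra borel \<and>
     (\<forall>A\<in>sets N. \<forall>B\<in>sets borel.
        emeasure M {x\<in>space M. V x \<in> A \<and> Y x \<in> B} = (\<integral>\<^sup>+ v\<in>A. emeasure (K v) B \<partial>distr M N V))"

end

theory Submission
  imports Defs
begin

text \<open>Two ideas carry the theorem. The first removes the parameters. Since \<open>X\<close> under \<open>(\<alpha>, \<beta>)\<close> is distributed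
  as \<open>diag \<beta> ** X + rep_cols \<alpha>\<close> under \<open>(0, 1)\<close> (\<open>ls_law_eq_distr\<close>), and since this transformation leaves
  the loss of an equivariant estimator unchanged, the Pitman closeness of two equivariant estimators
  does not depend on \<open>(\<alpha>, \<beta>)\<close> (\<open>pitman_closeness_equivariant\<close>). Every \<open>T - w(Z) Te\<close> is equivariant because
  \<open>Z\<close> is invariant, so all comparisons can be made under \<open>(0, 1)\<close>.

  The second turns the comparison of losses into a comparison of \<open>c\<^sup>*\<close> with the median. For almost every
  data matrix \<open>X\<close> the loss of \<open>T - c Te\<close> is a strictly convex function of the scalar \<open>c\<close> whose critical point is \<open>c\<^sup>*\<close>,
  hence it increases strictly as \<open>c\<close> moves away from \<open>c\<^sup>*\<close> to either side. Where \<open>w(Z) < m(Z)\<close>, the estimator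
  with \<open>w\<close> can be strictly better only if \<open>c\<^sup>* < m(Z)\<close>, while the estimator with \<open>m\<close> is strictly better
  as soon as \<open>c\<^sup>* \<ge> m(Z)\<close>. As \<open>m(Z)\<close> is a conditional median of \<open>c\<^sup>*\<close>, the first event has conditional
  probability at most \<open>1/2\<close> given \<open>Z\<close> and the second at least \<open>1/2\<close>. The case \<open>w(Z) > m(Z)\<close> is symmetric, and
  for \<open>w(Z) = m(Z)\<close> neither estimator wins. Integration over \<open>Z\<close> gives the claim
  (\<open>conditional_median_wins\<close>).\<close>

section \<open>Strict convexity along a line\<close>

lemma strictly_convex_imp_convex_on:
  assumes "strictly_convex \<phi>"
  shows "convex_on UNIV \<phi>"
proof (rule convex_onI)
  fix t x y :: real
  assume t: "0 < t" "t < 1"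
  show "\<phi> ((1 - t) *\<^sub>R x + t *\<^sub>R y) \<le> (1 - t) * \<phi> x + t * \<phi> y"
  proof (cases "x = y")
    case True
    then show ?thesis by (simp add: algebra_simps)
  next
    case False
    then have "\<phi> ((1 - t) * x + (1 - (1 - t)) * y) < (1 - t) * \<phi> x + (1 - (1 - t)) * \<phi> y"
      using assms t unfolding strictly_convex_def by (metis diff_gt_0_iff_gt diff_less_eq less_add_same_cancel1)
    then show ?thesis by simp
  qed
qed simp

lemma continuous_strictly_convex:
  "strictly_convex \<phi> \<Longrightarrow> continuous_on UNIV \<phi>"
  by (intro convex_on_continuous strictly_convex_imp_convex_on) auto

text \<open>A critical point \<open>c\<close> of a convex function is a global minimum, and strict convexity makes it the only
  one. A point \<open>a\<close> between \<open>c\<close> and \<open>b\<close> is a convex combination of them in which \<open>c\<close> has positive weight,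
  so its value falls strictly below the value at \<open>b\<close>.\<close>

lemma strictly_convex_less_of_nearer_critical_point:
  assumes conv: "strictly_convex \<phi>" and crit: "(\<phi> has_real_derivative 0) (at c)"
    and ab: "c \<le> a \<and> a < b \<or> b < a \<and> a \<le> c"
  shows "\<phi> a < \<phi> b"
proof -
  have min: "\<phi> c \<le> \<phi> x" for x
    using convex_on_imp_above_tangent[OF strictly_convex_imp_convex_on[OF conv], of c x 0] crit by simp
  have "c \<noteq> b" using ab by auto
  have strict: "\<phi> (t * c + (1 - t) * b) < t * \<phi> c + (1 - t) * \<phi> b" if "0 < t" "t < 1" for t
    using conv \<open>c \<noteq> b\<close> that unfolding strictly_convex_def by blast
  \<comment> \<open>The value at the midpoint is at least \<open>\<phi> c\<close> and lies strictly below the mean of \<open>\<phi> c\<close> and \<open>\<phi> b\<close>.\<close>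
  have cb: "\<phi> c < \<phi> b"
    using min[of "1/2 * c + (1 - 1/2) * b"] strict[of "1/2"] by (simp add: field_simps)
  define t where "t = (b - a) / (b - c)"
  have "t * (b - c) = b - a" using \<open>c \<noteq> b\<close> by (simp add: t_def)
  then have a: "a = t * c + (1 - t) * b" by (simp add: algebra_simps)
  have t: "0 < t" "t \<le> 1" using ab by (auto simp: t_def divide_simps)
  show ?thesis
  proof (cases "t = 1")
    case True
    then show ?thesis using cb a by simp
  next
    case False
    then have "\<phi> a < t * \<phi> c + (1 - t) * \<phi> b"
      unfolding a using strict t by simp
    also have "\<dots> \<le> t * \<phi> b + (1 - t) * \<phi> b"
      using cb t by simp
    finally show ?thesis by (simp add: algebra_simps)
  qed
qed

text \<open>The direction \<open>s\<close> has no zero entry, so distinct scalars give distinct arguments of \<open>h\<close> in every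
  coordinate, and the strict inequalities of the coordinates add up.\<close>

lemma strictly_convex_sum_loss_on_line:
  fixes d s :: "real^'p::finite"
  assumes h: "strictly_convex h" and s: "positive_vec s"
  shows "strictly_convex (\<lambda>c. sum_loss h (d - c *\<^sub>R s) 0 1)"
  unfolding strictly_convex_def
proof (intro allI impI)
  fix x y t :: real
  assume "x \<noteq> y" and t: "0 < t" "t < 1"
  have "sum_loss h (d - (t * x + (1 - t) * y) *\<^sub>R s) 0 1
      = (\<Sum>i\<in>UNIV. h (t * (d $ i - x * s $ i) + (1 - t) * (d $ i - y * s $ i)))"
    unfolding sum_loss_def by (intro sum.cong) (auto simp: algebra_simps)
  also have "\<dots> < (\<Sum>i\<in>UNIV. t * h (d $ i - x * s $ i) + (1 - t) * h (d $ i - y * s $ i))"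
  proof (rule sum_strict_mono)
    fix i
    have "s $ i \<noteq> 0" using s by (auto simp: positive_vec_def dest: spec[of _ i])
    then have "d $ i - x * s $ i \<noteq> d $ i - y * s $ i" using \<open>x \<noteq> y\<close> by simp
    then show "h (t * (d $ i - x * s $ i) + (1 - t) * (d $ i - y * s $ i))
      < t * h (d $ i - x * s $ i) + (1 - t) * h (d $ i - y * s $ i)"
      using h t unfolding strictly_convex_def by blast
  qed auto
  also have "\<dots> = t * sum_loss h (d - x *\<^sub>R s) 0 1 + (1 - t) * sum_loss h (d - y *\<^sub>R s) 0 1"
    by (simp add: sum_loss_def sum.distrib sum_distrib_left)
  finally show "sum_loss h (d - (t * x + (1 - t) * y) *\<^sub>R s) 0 1
    < t * sum_loss h (d - x *\<^sub>R s) 0 1 + (1 - t) * sum_loss h (d - y *\<^sub>R s) 0 1" .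
qed

text \<open>The chain rule that makes the defining equation of \<open>c\<^sup>*\<close> say that \<open>c\<^sup>*\<close> is a critical point of the loss
  restricted to a line.\<close>

lemma GDERIV_imp_derivative_on_line:
  fixes s :: "'a::real_inner"
  assumes "GDERIV F (d - c *\<^sub>R s) :> D"
  shows "((\<lambda>c. F (d - c *\<^sub>R s)) has_real_derivative - (s \<bullet> D)) (at c)"
proof -
  have "((\<lambda>c. d - c *\<^sub>R s) has_derivative (\<lambda>x. - (x *\<^sub>R s))) (at c)"
    by (auto intro!: derivative_eq_intros)
  from has_derivative_compose[OF this assms[unfolded gderiv_def]]
  show ?thesis
    unfolding has_field_derivative_def by (rule has_derivative_eq_rhs) (auto simp: mult.commute)
qed

section \<open>Conditional distributions and medians\<close>

text \<open>The defining identity of a conditional distribution concerns rectangles \<open>A \<times> B\<close> only. Comparing \<open>Y\<close> with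
  a threshold that depends on \<open>V\<close> needs it for every measurable set of pairs. Both sides are finite
  measures of that set, the right-hand side being a composition of the law of \<open>V\<close> with a kernel, and they
  agree on the intersection-stable generator of rectangles.\<close>

lemma emeasure_via_cond_distr:
  assumes M: "prob_space M" and V[measurable]: "V \<in> M \<rightarrow>\<^sub>M N" and Y[measurable]: "Y \<in> borel_measurable M"
    and cd: "is_cond_distr M N V Y K" and S: "S \<in> sets (N \<Otimes>\<^sub>M borel)"
  shows "emeasure M {x\<in>space M. (V x, Y x) \<in> S} = (\<integral>\<^sup>+ v. emeasure (K v) (Pair v -` S) \<partial>distr M N V)"
proof -
  interpret M: prob_space M by fact
  interpret D: prob_space "distr M N V" by (rule M.prob_space_distr) fact
  let ?D = "distr M N V"
  let ?E = "{a \<times> b |a b. a \<in> sets N \<and> b \<in> sets (borel :: real measure)}"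
  let ?G = "\<lambda>v. distr (K v) (N \<Otimes>\<^sub>M borel) (Pair v)"
  have K: "K \<in> N \<rightarrow>\<^sub>M prob_algebra borel"
    using cd by (simp add: is_cond_distr_def)
  have Kv: "sets (K v) = sets borel" if "v \<in> space N" for v
    using measurable_space[OF K that] by (auto simp: space_prob_algebra)
  have G: "?G \<in> ?D \<rightarrow>\<^sub>M subprob_algebra (N \<Otimes>\<^sub>M borel)"
    using measurable_distr2[of Pair N borel "N \<Otimes>\<^sub>M borel" K] measurable_prob_algebraD[OF K] by simp
  have ne: "space ?D \<noteq> {}" by (rule D.not_empty)
  have emG: "emeasure (?G v) A = emeasure (K v) (Pair v -` A)"
    if "v \<in> space N" "A \<in> sets (N \<Otimes>\<^sub>M borel)" for v A
    using that sets_eq_imp_space_eq[OF Kv[OF that(1)]]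
    by (subst emeasure_distr) (auto cong: measurable_cong_sets[OF Kv refl])
  have em: "emeasure (?D \<bind> ?G) A = (\<integral>\<^sup>+ v. emeasure (K v) (Pair v -` A) \<partial>?D)"
    if "A \<in> sets (N \<Otimes>\<^sub>M borel)" for A
    by (subst emeasure_bind[OF ne G that]) (intro nn_integral_cong, simp add: emG that)
  have "distr M (N \<Otimes>\<^sub>M borel) (\<lambda>x. (V x, Y x)) = ?D \<bind> ?G"
  proof (rule measure_eqI_generator_eq[OF Int_stable_pair_measure_generator[of N borel],
        where A = "\<lambda>_. space N \<times> UNIV" and \<Omega> = "space N \<times> UNIV"])
    show "?E \<subseteq> Pow (space N \<times> UNIV)"
      using sets.space_closed[of N] by auto
    show "sets (distr M (N \<Otimes>\<^sub>M borel) (\<lambda>x. (V x, Y x))) = sigma_sets (space N \<times> UNIV) ?E"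
      by (simp add: sets_pair_measure)
    show "sets (?D \<bind> ?G) = sigma_sets (space N \<times> UNIV) ?E"
      by (subst sets_bind[where N = "N \<Otimes>\<^sub>M borel"]) (use ne in \<open>auto simp: sets_pair_measure\<close>)
    show "range (\<lambda>_::nat. space N \<times> UNIV) \<subseteq> ?E"
      by (intro image_subsetI CollectI exI[of _ "space N"] exI[of _ UNIV]) auto
    fix A assume "A \<in> ?E"
    then obtain a b where A: "A = a \<times> b" and [measurable]: "a \<in> sets N" "b \<in> sets borel" by auto
    have "emeasure (distr M (N \<Otimes>\<^sub>M borel) (\<lambda>x. (V x, Y x))) A = emeasure M {x\<in>space M. V x \<in> a \<and> Y x \<in> b}"
      unfolding A by (subst emeasure_distr) (auto intro!: arg_cong[where f="emeasure M"])
    also have "\<dots> = (\<integral>\<^sup>+ v\<in>a. emeasure (K v) b \<partial>?D)"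
      using cd by (simp add: is_cond_distr_def)
    also have "\<dots> = emeasure (?D \<bind> ?G) A"
      by (subst em) (auto simp: A vimage_def intro!: nn_integral_cong split: split_indicator)
    finally show "emeasure (distr M (N \<Otimes>\<^sub>M borel) (\<lambda>x. (V x, Y x))) A = emeasure (?D \<bind> ?G) A" .
  next
    show "emeasure (distr M (N \<Otimes>\<^sub>M borel) (\<lambda>x. (V x, Y x))) (space N \<times> UNIV) \<noteq> \<infinity>"
      by (subst emeasure_distr) auto
  qed auto
  moreover have "emeasure (distr M (N \<Otimes>\<^sub>M borel) (\<lambda>x. (V x, Y x))) S = emeasure M {x\<in>space M. (V x, Y x) \<in> S}"
    using S by (subst emeasure_distr) (auto intro!: arg_cong[where f="emeasure M"])
  ultimately show ?thesis using em[OF S] by simp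
qed

lemma is_median_tails:
  assumes "prob_space W" and [simp]: "sets W = sets borel" and "is_median W m"
  shows "emeasure W {..<m} \<le> emeasure W {m..}" and "emeasure W {m<..} \<le> emeasure W {..m}"
proof -
  interpret prob_space W by fact
  have sp: "space W = UNIV" using sets_eq_imp_space_eq[OF assms(2)] by simp
  have "{m..} = space W - {..<m}" "{m<..} = space W - {..m}" by (auto simp: sp)
  then have "prob {m..} = 1 - prob {..<m}" "prob {m<..} = 1 - prob {..m}"
    using prob_compl[of "{..<m}"] prob_compl[of "{..m}"] by simp_all
  then show "emeasure W {..<m} \<le> emeasure W {m..}" "emeasure W {m<..} \<le> emeasure W {..m}"
    using assms(3) by (auto simp: is_median_def emeasure_eq_measure)
qed

text \<open>The heart of the argument, free of the statistical model: \<open>g x c\<close> is the loss incurred by the choice \<open>c\<close>,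
  it grows strictly with the distance of \<open>c\<close> from the optimum \<open>Y x\<close> on either side, and a choice may
  depend on \<open>x\<close> only through \<open>V x\<close>. The choice of a conditional median of \<open>Y\<close> is then beaten at most as often
  as it wins.\<close>

lemma conditional_median_wins:
  fixes g :: "'a \<Rightarrow> real \<Rightarrow> real" and Y :: "'a \<Rightarrow> real" and m w :: "'b \<Rightarrow> real"
  assumes M: "prob_space M" and V[measurable]: "V \<in> M \<rightarrow>\<^sub>M N" and Y[measurable]: "Y \<in> borel_measurable M"
    and cd: "is_cond_distr M N V Y K"
    and m[measurable]: "m \<in> borel_measurable N" and w[measurable]: "w \<in> borel_measurable N"
    and med: "AE v in distr M N V. is_median (K v) (m v)"
    and g: "AE x in M. \<forall>a b. Y x \<le> a \<and> a < b \<or> b < a \<and> a \<le> Y x \<longrightarrow> g x a < g x b"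
    and [measurable]: "(\<lambda>x. g x (m (V x))) \<in> borel_measurable M" "(\<lambda>x. g x (w (V x))) \<in> borel_measurable M"
  shows "measure M {x\<in>space M. g x (w (V x)) < g x (m (V x))}
       \<le> measure M {x\<in>space M. g x (m (V x)) < g x (w (V x))}"
proof -
  interpret M: prob_space M by fact
  \<comment> \<open>Up to null sets, \<open>?lose\<close> describes a superset of the event that \<open>w\<close> beats \<open>m\<close>, and \<open>?win\<close> a subset of
    the event that \<open>m\<close> beats \<open>w\<close>. A nonempty section of \<open>?lose\<close> is an open half-line that ends at the median,
    and the section of \<open>?win\<close> at the same point is the complementary closed half-line.\<close>
  let ?lose = "{(v, y) \<in> space N \<times> UNIV. w v < m v \<and> y < m v \<or> m v < w v \<and> m v < y}"
  let ?win = "{(v, y) \<in> space N \<times> UNIV. w v < m v \<and> m v \<le> y \<or> m v < w v \<and> y \<le> m v}"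
  have sets: "?lose \<in> sets (N \<Otimes>\<^sub>M borel)" "?win \<in> sets (N \<Otimes>\<^sub>M borel)"
  proof -
    have "{p \<in> space (N \<Otimes>\<^sub>M borel). w (fst p) < m (fst p) \<and> snd p < m (fst p) \<or> m (fst p) < w (fst p) \<and> m (fst p) < snd p}
          \<in> sets (N \<Otimes>\<^sub>M borel)" by measurable
    also have "{p \<in> space (N \<Otimes>\<^sub>M borel). w (fst p) < m (fst p) \<and> snd p < m (fst p) \<or> m (fst p) < w (fst p) \<and> m (fst p) < snd p} = ?lose"
      by (auto simp: space_pair_measure)
    finally show "?lose \<in> sets (N \<Otimes>\<^sub>M borel)" .
    have "{p \<in> space (N \<Otimes>\<^sub>M borel). w (fst p) < m (fst p) \<and> m (fst p) \<le> snd p \<or> m (fst p) < w (fst p) \<and> snd p \<le> m (fst p)}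
          \<in> sets (N \<Otimes>\<^sub>M borel)" by measurable
    also have "{p \<in> space (N \<Otimes>\<^sub>M borel). w (fst p) < m (fst p) \<and> m (fst p) \<le> snd p \<or> m (fst p) < w (fst p) \<and> snd p \<le> m (fst p)} = ?win"
      by (auto simp: space_pair_measure)
    finally show "?win \<in> sets (N \<Otimes>\<^sub>M borel)" .
  qed
  have [measurable]: "{x\<in>space M. (V x, Y x) \<in> ?lose} \<in> sets M" "{x\<in>space M. (V x, Y x) \<in> ?win} \<in> sets M"
    using measurable_sets[OF measurable_Pair[OF V Y] sets(1)] measurable_sets[OF measurable_Pair[OF V Y] sets(2)]
    by (simp_all add: vimage_def Int_def conj_commute)
  have "emeasure M {x\<in>space M. g x (w (V x)) < g x (m (V x))} \<le> emeasure M {x\<in>space M. (V x, Y x) \<in> ?lose}"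
  proof (rule emeasure_mono_AE)
    show "AE x in M. x \<in> {x\<in>space M. g x (w (V x)) < g x (m (V x))} \<longrightarrow> x \<in> {x\<in>space M. (V x, Y x) \<in> ?lose}"
      using g
    proof eventually_elim
      case (elim x)
      show ?case
      proof
        assume "x \<in> {x\<in>space M. g x (w (V x)) < g x (m (V x))}"
        then have x: "x \<in> space M" and less: "g x (w (V x)) < g x (m (V x))" by auto
        have "\<not> (Y x \<le> m (V x) \<and> m (V x) < w (V x) \<or> w (V x) < m (V x) \<and> m (V x) \<le> Y x)"
          using elim less by (meson less_asym)
        moreover have "w (V x) \<noteq> m (V x)" using less by auto
        ultimately show "x \<in> {x\<in>space M. (V x, Y x) \<in> ?lose}"
          using x measurable_space[OF V x] by auto
      qed
    qed
  qed simp
  also have "\<dots> = (\<integral>\<^sup>+ v. emeasure (K v) (Pair v -` ?lose) \<partial>distr M N V)"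
    by (rule emeasure_via_cond_distr[OF M V Y cd sets(1)])
  also have "\<dots> \<le> (\<integral>\<^sup>+ v. emeasure (K v) (Pair v -` ?win) \<partial>distr M N V)"
  proof (rule nn_integral_mono_AE)
    have "AE v in distr M N V. v \<in> space N" by (metis AE_space space_distr)
    with med show "AE v in distr M N V. emeasure (K v) (Pair v -` ?lose) \<le> emeasure (K v) (Pair v -` ?win)"
    proof eventually_elim
      case (elim v)
      have "K v \<in> space (prob_algebra borel)"
        using measurable_space[of K N "prob_algebra borel" v] cd elim(2) by (simp add: is_cond_distr_def)
      then have "prob_space (K v)" "sets (K v) = sets borel"
        by (auto simp: space_prob_algebra)
      note tails = is_median_tails[OF this elim(1)]
      consider "w v < m v" | "m v < w v" | "w v = m v" by linarith
      then show ?case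
      proof cases
        case 1
        then have "Pair v -` ?lose = {..<m v}" "Pair v -` ?win = {m v..}" using elim by auto
        then show ?thesis using tails(1) by simp
      next
        case 2
        then have "Pair v -` ?lose = {m v<..}" "Pair v -` ?win = {..m v}" using elim by auto
        then show ?thesis using tails(2) by simp
      next
        case 3
        then have none: "Pair v -` ?lose = {}" by auto
        show ?thesis unfolding none by simp
      qed
    qed
  qed
  also have "\<dots> = emeasure M {x\<in>space M. (V x, Y x) \<in> ?win}"
    by (rule emeasure_via_cond_distr[OF M V Y cd sets(2), symmetric])
  also have "\<dots> \<le> emeasure M {x\<in>space M. g x (m (V x)) < g x (w (V x))}"
  proof (rule emeasure_mono_AE)
    show "AE x in M. x \<in> {x\<in>space M. (V x, Y x) \<in> ?win} \<longrightarrow> x \<in> {x\<in>space M. g x (m (V x)) < g x (w (V x))}"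
      using g by eventually_elim auto
  qed simp
  finally show ?thesis
    by (simp add: M.emeasure_eq_measure)
qed

section \<open>The group action\<close>

lemma diag_nth: "diag c $ i $ j = (if i = j then c $ i else 0)"
  by (simp add: diag_def)

lemma diag_mult_nth [simp]: "(diag c ** X) $ i $ j = c $ i * X $ i $ j"
  by (simp add: diag_def matrix_matrix_mult_def if_distrib[of "\<lambda>a. a * _"] cong: if_cong)

lemma diag_mult_vec_nth [simp]: "(diag c *v x) $ i = c $ i * x $ i"
  by (simp add: diag_def matrix_vector_mult_def if_distrib[of "\<lambda>a. a * _"] cong: if_cong)

lemma rep_cols_nth [simp]: "rep_cols a $ i $ j = a $ i"
  by (simp add: rep_cols_def)

lemma matrix_inv_diag_cancel:
  fixes X :: "real^'n::finite^'p::finite"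
  assumes "positive_vec \<beta>"
  shows "matrix_inv (diag \<beta>) ** (diag \<beta> ** X) = X"
proof -
  have inverse: "diag a ** diag b = mat 1" if "\<And>i. a $ i * b $ i = 1" for a b :: "real^'p"
  proof -
    have "(diag a ** diag b) $ i $ j = mat 1 $ i $ j" for i j
      using that by (simp add: diag_nth mat_def)
    then show ?thesis by (simp add: vec_eq_iff)
  qed
  have "\<beta> $ i \<noteq> 0" for i
    using assms by (auto simp: positive_vec_def dest: spec[of _ i])
  then have "diag \<beta> ** diag (\<chi> i. 1 / \<beta> $ i) = mat 1 \<and> diag (\<chi> i. 1 / \<beta> $ i) ** diag \<beta> = mat 1"
    by (intro conjI inverse) auto
  then have "matrix_inv (diag \<beta>) ** diag \<beta> = mat 1"
    unfolding matrix_inv_def by (rule someI2) simp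
  then show ?thesis by (simp add: matrix_mul_assoc)
qed

lemma U_of_affine: "U_of (diag c ** X + rep_cols a) = diag c ** U_of X"
  by (simp add: U_of_def vec_eq_iff right_diff_distrib)

text \<open>A positive scale cancels in every quotient, including the sign \<open>u / \<bar>u\<bar>\<close>; a vanishing denominator stays zero,
  so the equality holds everywhere and not only almost everywhere.\<close>

lemma Z_of_diag:
  assumes "positive_vec c"
  shows "Z_of j1 (diag c ** U) = Z_of j1 U"
proof -
  have pos: "0 < c $ i" for i using assms by (simp add: positive_vec_def)
  have nz: "c $ i \<noteq> 0" and abs: "\<bar>c $ i\<bar> = c $ i" for i using pos[of i] by auto
  show ?thesis
    by (simp add: Z_of_def vec_eq_iff abs_mult nz abs)
qed

lemma sum_loss_affine:
  assumes "positive_vec \<beta>"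
  shows "sum_loss h (diag \<beta> *v d + \<alpha>) \<alpha> \<beta> = sum_loss h d 0 1"
proof -
  have "\<beta> $ i \<noteq> 0" for i
    using assms by (auto simp: positive_vec_def dest: spec[of _ i])
  then show ?thesis by (simp add: sum_loss_def)
qed

text \<open>The standard basis of a matrix space consists of the matrix units. This indexing by positions is what
  produces the power \<open>det ^ CARD('n)\<close> of the Jacobian below.\<close>

lemma prod_Basis_matrix:
  "(\<Prod>b\<in>(Basis :: (real^'n::finite^'p::finite) set). F b) = (\<Prod>i\<in>UNIV. \<Prod>j\<in>UNIV. F (axis i (axis j 1)))"
proof -
  have bij: "bij_betw (\<lambda>(i, j). axis i (axis j 1)) (UNIV \<times> UNIV) (Basis :: (real^'n^'p) set)"
  proof (rule bij_betw_imageI)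
    show "inj_on (\<lambda>(i, j). axis i (axis j (1::real)) :: real^'n^'p) (UNIV \<times> UNIV)"
      by (rule inj_onI) (clarsimp simp: axis_eq_axis)
    have "b \<in> (\<lambda>(i, j). axis i (axis j 1)) ` (UNIV \<times> UNIV) \<longleftrightarrow> (\<exists>i j. b = axis i (axis j 1))" for b :: "real^'n^'p"
      by (simp add: image_iff)
    moreover have "b \<in> Basis \<longleftrightarrow> (\<exists>i j. b = axis i (axis j 1))" for b :: "real^'n^'p"
      unfolding Basis_vec_def by simp
    ultimately show "(\<lambda>(i, j). axis i (axis j 1)) ` (UNIV \<times> UNIV) = (Basis :: (real^'n^'p) set)"
      by blast
  qed
  have "(\<Prod>b\<in>(Basis :: (real^'n^'p) set). F b) = (\<Prod>(i, j)\<in>UNIV \<times> UNIV. F (axis i (axis j 1)))"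
    unfolding prod.reindex_bij_betw[OF bij, symmetric] by (intro prod.cong) auto
  then show ?thesis by (simp only: prod.cartesian_product)
qed

text \<open>The map scales each of the \<open>CARD('n)\<close> entries of row \<open>i\<close> by \<open>\<beta> $ i\<close>, so it is diagonal in the standard basis
  of the matrix space and its Jacobian is \<open>(\<Prod>i. \<beta> $ i) ^ CARD('n)\<close>.\<close>

lemma lborel_diag_affine:
  fixes \<alpha> \<beta> :: "real^'p::finite"
  assumes "positive_vec \<beta>"
  shows "(lborel :: (real^'n::finite^'p) measure)
    = density (distr lborel borel (\<lambda>X. diag \<beta> ** X + rep_cols \<alpha>)) (\<lambda>_. ennreal (det (diag \<beta>) ^ CARD('n)))"
proof -
  have pos: "0 < \<beta> $ i" for i using assms by (simp add: positive_vec_def)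
  \<comment> \<open>\<open>c b\<close> is the scale factor of the map in the direction of the matrix unit \<open>b\<close>.\<close>
  define c :: "real^'n^'p \<Rightarrow> real" where "c b = b \<bullet> (diag \<beta> ** b)" for b
  have c: "c (axis i (axis j 1)) = \<beta> $ i" for i j
    by (simp add: c_def inner_axis')
  have B: "b \<in> Basis \<Longrightarrow> \<exists>i j. b = axis i (axis j 1)" for b :: "real^'n^'p"
    by (auto simp: Basis_vec_def)
  have cpos: "0 < c b" if "b \<in> Basis" for b
    using B[OF that] pos c by auto
  have T: "rep_cols \<alpha> + (\<Sum>b\<in>Basis. (c b * (X \<bullet> b)) *\<^sub>R b) = diag \<beta> ** X + rep_cols \<alpha>" for X :: "real^'n^'p"
  proof -
    have "(\<Sum>b\<in>Basis. (c b * (X \<bullet> b)) *\<^sub>R b) = diag \<beta> ** X"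
    proof (rule euclidean_eqI)
      fix b :: "real^'n^'p" assume b: "b \<in> Basis"
      then have "(\<Sum>b\<in>Basis. (c b * (X \<bullet> b)) *\<^sub>R b) \<bullet> b = c b * (X \<bullet> b)" by simp
      also have "\<dots> = (diag \<beta> ** X) \<bullet> b"
        using B[OF b] by (auto simp: c inner_axis)
      finally show "(\<Sum>b\<in>Basis. (c b * (X \<bullet> b)) *\<^sub>R b) \<bullet> b = (diag \<beta> ** X) \<bullet> b" .
    qed
    then show ?thesis by simp
  qed
  have "(\<Prod>b\<in>Basis. \<bar>c b\<bar>) = (\<Prod>i\<in>UNIV. \<beta> $ i ^ CARD('n))"
    using pos by (simp add: prod_Basis_matrix c abs_of_pos)
  also have "\<dots> = det (diag \<beta>) ^ CARD('n)"
    by (subst det_diagonal) (auto simp: diag_def prod_power_distrib)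
  finally have P: "(\<Prod>b\<in>Basis. \<bar>c b\<bar>) = det (diag \<beta>) ^ CARD('n)" .
  show ?thesis
    using lborel_affine_euclidean[of c "rep_cols \<alpha>"] cpos unfolding T P by (metis less_irrefl)
qed

lemma measurable_affine [measurable]:
  "(\<lambda>X::real^'n::finite^'p::finite. diag \<beta> ** X + rep_cols \<alpha>) \<in> borel_measurable borel"
  by (rule borel_measurable_continuous_onI)
     (auto simp: matrix_matrix_mult_def intro!: continuous_intros)

text \<open>The Jacobian of the affine map is exactly the normalising factor in the density of the family, so the
  family is the orbit of the law with density \<open>f\<close>.\<close>

lemma ls_law_eq_distr:
  fixes f :: "real^'n::finite^'p::finite \<Rightarrow> real"
  assumes f[measurable]: "f \<in> borel_measurable borel" and \<beta>: "positive_vec \<beta>"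
  shows "ls_law f \<alpha> \<beta> = distr (density lborel f) borel (\<lambda>X. diag \<beta> ** X + rep_cols \<alpha>)"
proof -
  let ?A = "\<lambda>X::real^'n^'p. diag \<beta> ** X + rep_cols \<alpha>"
  let ?k = "det (diag \<beta>) ^ CARD('n)"
  have det: "0 < det (diag \<beta>)"
    using \<beta> by (subst det_diagonal) (auto simp: diag_def positive_vec_def intro!: prod_pos)
  have [measurable]: "(\<lambda>X. f (matrix_inv (diag \<beta>) ** (X - rep_cols \<alpha>))) \<in> borel_measurable borel"
    by (rule measurable_compose[OF borel_measurable_continuous_onI f])
       (auto simp: matrix_matrix_mult_def intro!: continuous_intros)
  have "ls_law f \<alpha> \<beta> = density (density (distr lborel borel ?A) (\<lambda>_. ennreal ?k)) (\<lambda>X. ennreal (ls_density f \<alpha> \<beta> X))"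
    unfolding ls_law_def by (subst lborel_diag_affine[OF \<beta>, of \<alpha>]) (rule refl)
  also have "\<dots> = density (distr lborel borel ?A) (\<lambda>X. ennreal ?k * ennreal (ls_density f \<alpha> \<beta> X))"
    by (rule density_density_eq) (auto simp: ls_density_def)
  also have "\<dots> = density (distr lborel borel ?A) (\<lambda>X. ennreal (f (matrix_inv (diag \<beta>) ** (X - rep_cols \<alpha>))))"
    using det by (intro arg_cong[where f="density _"]) (auto simp: ls_density_def ennreal_mult'[symmetric])
  also have "\<dots> = distr (density lborel (\<lambda>X. ennreal (f (matrix_inv (diag \<beta>) ** (?A X - rep_cols \<alpha>))))) borel ?A"
    by (rule density_distr) auto
  also have "\<dots> = distr (density lborel f) borel ?A"
    by (simp add: matrix_inv_diag_cancel[OF \<beta>])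
  finally show ?thesis .
qed

lemma ls_law_0_1:
  fixes f :: "real^'n::finite^'p::finite \<Rightarrow> real"
  shows "ls_law f 0 1 = density lborel f"
proof -
  have d: "diag (1 :: real^'p) = mat 1" by (simp add: diag_def mat_def vec_eq_iff)
  have "matrix_inv (mat 1 :: real^'p^'p) ** X = X" for X :: "real^'n^'p"
    using matrix_inv_diag_cancel[of "1 :: real^'p" X] by (simp add: d positive_vec_def)
  moreover have "rep_cols 0 = (0 :: real^'n^'p)" by (simp add: vec_eq_iff)
  ultimately show ?thesis
    by (simp add: ls_law_def ls_density_def d)
qed

section \<open>Measurability\<close>

lemma borel_measurable_vecI:
  fixes F :: "'a \<Rightarrow> 'b::euclidean_space^'n::finite"
  assumes "\<And>i. (\<lambda>x. F x $ i) \<in> borel_measurable M"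
  shows "F \<in> borel_measurable M"
proof (subst borel_measurable_euclidean_space, intro ballI)
  fix b :: "'b^'n" assume "b \<in> Basis"
  then obtain i u where "b = axis i u" by (auto simp: Basis_vec_def)
  then show "(\<lambda>x. F x \<bullet> b) \<in> borel_measurable M"
    using assms[of i] by (simp add: inner_axis)
qed

lemma borel_measurable_vec_entry [measurable]:
  "(\<lambda>x::'b::euclidean_space^'n::finite. x $ i) \<in> borel_measurable borel"
  by (intro borel_measurable_continuous_onI continuous_intros)

lemma measurable_U_of [measurable]: "U_of \<in> borel_measurable borel"
  unfolding U_of_def by (intro borel_measurable_vecI) simp

lemma measurable_Z_of [measurable]: "Z_of j1 \<in> borel_measurable borel"
  unfolding Z_of_def by (intro borel_measurable_vecI) simp

lemma measurable_sum_loss: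
  assumes h: "strictly_convex h" and d: "d \<in> borel_measurable M"
  shows "(\<lambda>x. sum_loss h (d x) \<alpha> \<beta>) \<in> borel_measurable M"
proof -
  have [measurable]: "h \<in> borel_measurable borel"
    by (intro borel_measurable_continuous_onI continuous_strictly_convex h)
  note d[measurable]
  show ?thesis unfolding sum_loss_def by measurable
qed

lemma equivariant_correction:
  assumes T: "equivariant_estimator T" and Te: "scale_equivariant_statistic Te"
    and [measurable]: "w \<in> borel_measurable borel"
  shows "equivariant_estimator (\<lambda>X. T X - w (Z_of j1 (U_of X)) *\<^sub>R Te (U_of X))"
proof -
  have [measurable]: "T \<in> borel_measurable borel" "Te \<in> borel_measurable borel"
    using T Te by (simp_all add: equivariant_estimator_def scale_equivariant_statistic_def)
  show ?thesis
    using T Te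
    by (auto simp: equivariant_estimator_def scale_equivariant_statistic_def U_of_affine Z_of_diag
        matrix_vector_mult_diff_distrib matrix_vector_mult_scaleR)
qed

text \<open>Pull the event back along the affine map that generates the law. Equivariance moves the map out of both
  estimators, and the loss absorbs it.\<close>

lemma pitman_closeness_equivariant:
  fixes f :: "real^'n::finite^'p::finite \<Rightarrow> real"
  assumes f: "f \<in> borel_measurable borel" and h: "strictly_convex h"
    and T1: "equivariant_estimator T1" and T2: "equivariant_estimator T2" and \<beta>: "positive_vec \<beta>"
  shows "pitman_closeness f (sum_loss h) T1 T2 \<alpha> \<beta>
    = measure (ls_law f 0 1) {X. sum_loss h (T1 X) 0 1 < sum_loss h (T2 X) 0 1}"
proof -
  let ?S = "{X. sum_loss h (T1 X) \<alpha> \<beta> < sum_loss h (T2 X) \<alpha> \<beta>}"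
  let ?A = "\<lambda>X::real^'n^'p. diag \<beta> ** X + rep_cols \<alpha>"
  have [measurable]: "T1 \<in> borel_measurable borel" "T2 \<in> borel_measurable borel"
    using T1 T2 by (simp_all add: equivariant_estimator_def)
  have [measurable]: "(\<lambda>X. sum_loss h (T1 X) \<alpha> \<beta>) \<in> borel_measurable borel" "(\<lambda>X. sum_loss h (T2 X) \<alpha> \<beta>) \<in> borel_measurable borel"
    by (intro measurable_sum_loss h, measurable)+
  have "?S = {X \<in> space borel. sum_loss h (T1 X) \<alpha> \<beta> < sum_loss h (T2 X) \<alpha> \<beta>}" by simp
  also have "\<dots> \<in> sets borel" by measurable
  finally have S: "?S \<in> sets borel" .
  have loss: "sum_loss h (\<delta> (?A X)) \<alpha> \<beta> = sum_loss h (\<delta> X) 0 1" if "equivariant_estimator \<delta>" for \<delta> X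
    using that \<beta> by (simp add: equivariant_estimator_def sum_loss_affine)
  have "pitman_closeness f (sum_loss h) T1 T2 \<alpha> \<beta> = measure (density lborel f) (?A -` ?S)"
    unfolding pitman_closeness_def ls_law_eq_distr[OF f \<beta>] using S by (subst measure_distr) auto
  also have "?A -` ?S = {X. sum_loss h (T1 X) 0 1 < sum_loss h (T2 X) 0 1}"
    by (simp add: vimage_def loss T1 T2)
  finally show ?thesis by (simp add: ls_law_0_1)
qed

section \<open>The Pitman closest estimator\<close>

theorem theorem4p4:
  fixes f :: "real^('k::finite option)^'p::finite \<Rightarrow> real"
    and j1 :: 'k
    and T :: "real^('k option)^'p \<Rightarrow> real^'p"
    and Te :: "real^'k^'p \<Rightarrow> real^'p"
    and h :: "real \<Rightarrow> real"
    and cstar :: "real^('k option)^'p \<Rightarrow> real"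
    and K :: "real^'k^'p \<Rightarrow> real measure"
    and m :: "real^'k^'p \<Rightarrow> real"
  assumes "is_density f"
    and "equivariant_estimator T"
    and "scale_equivariant_statistic Te"
    and "AE X in ls_law f 0 1. positive_vec (Te (U_of X))"
    and "strictly_convex h"
    and "cstar \<in> borel_measurable borel"
    and "AE X in ls_law f 0 1. \<exists>D. GDERIV (\<lambda>e. sum_loss h e 0 1) (T X - cstar X *\<^sub>R Te (U_of X)) :> D
           \<and> Te (U_of X) \<bullet> D = 0"
    and "is_cond_distr (ls_law f 0 1) borel (\<lambda>X. Z_of j1 (U_of X)) cstar K"
    and "m \<in> borel_measurable borel"
    and "AE z in distr (ls_law f 0 1) borel (\<lambda>X. Z_of j1 (U_of X)). is_median (K z) (m z)"
  shows "pitman_closest f (sum_loss h) (estimator_class j1 T Te)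
           (\<lambda>X. T X - m (Z_of j1 (U_of X)) *\<^sub>R Te (U_of X))"
proof -
  let ?M = "ls_law f 0 1"
  let ?\<delta> = "\<lambda>w X. T X - w (Z_of j1 (U_of X)) *\<^sub>R Te (U_of X)"
  define g where "g X c = sum_loss h (T X - c *\<^sub>R Te (U_of X)) 0 1" for X c
  have f: "f \<in> borel_measurable borel" and M: "prob_space ?M"
    using assms(1) by (auto simp: is_density_def ls_law_0_1)
  have setsM [measurable_cong, simp]: "sets ?M = sets borel" and [simp]: "space ?M = UNIV"
    by (simp_all add: ls_law_def)
  have [measurable]: "T \<in> borel_measurable borel" "Te \<in> borel_measurable borel"
    using assms(2,3) by (simp_all add: equivariant_estimator_def scale_equivariant_statistic_def)
  note assms(6,9)[measurable]
  \<comment> \<open>The gradient equation that defines \<open>c\<^sup>*\<close> enters here, and only here.\<close>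
  have unimodal: "AE X in ?M. \<forall>a b. cstar X \<le> a \<and> a < b \<or> b < a \<and> a \<le> cstar X \<longrightarrow> g X a < g X b"
    using assms(4,7)
  proof eventually_elim
    case (elim X)
    then obtain D where "GDERIV (\<lambda>e. sum_loss h e 0 1) (T X - cstar X *\<^sub>R Te (U_of X)) :> D" "Te (U_of X) \<bullet> D = 0"
      by auto
    then have "(g X has_real_derivative 0) (at (cstar X))"
      using GDERIV_imp_derivative_on_line unfolding g_def by fastforce
    moreover have "strictly_convex (g X)"
      unfolding g_def by (rule strictly_convex_sum_loss_on_line[OF assms(5) elim(1)])
    ultimately show ?case
      using strictly_convex_less_of_nearer_critical_point by blast
  qed
  have meas: "(\<lambda>X. g X (w (Z_of j1 (U_of X)))) \<in> borel_measurable ?M"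
    if [measurable]: "w \<in> borel_measurable borel" for w
    unfolding g_def by (intro measurable_sum_loss assms(5)) measurable
  have closer: "pitman_closeness f (sum_loss h) (?\<delta> m) (?\<delta> w) \<alpha> \<beta>
      \<ge> pitman_closeness f (sum_loss h) (?\<delta> w) (?\<delta> m) \<alpha> \<beta>"
    if w: "w \<in> borel_measurable borel" and \<beta>: "positive_vec \<beta>" for w \<alpha> \<beta>
  proof -
    note eq = equivariant_correction[OF assms(2,3)]
    have "(\<lambda>X. Z_of j1 (U_of X)) \<in> ?M \<rightarrow>\<^sub>M borel" "cstar \<in> borel_measurable ?M"
      by measurable
    from conditional_median_wins[OF M this assms(8,9) w assms(10) unimodal meas[OF assms(9)] meas[OF w]]
    show ?thesis
      unfolding pitman_closeness_equivariant[OF f assms(5) eq[OF assms(9)] eq[OF w] \<beta>]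
        pitman_closeness_equivariant[OF f assms(5) eq[OF w] eq[OF assms(9)] \<beta>]
      by (simp add: g_def)
  qed
  show ?thesis
    unfolding pitman_closest_def estimator_class_def
    using equivariant_correction[OF assms(2,3,9)] assms(9) closer by auto
qed

end
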